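(* Let $r\ge1$ and $u_p=\sum_{j=1}^{r}\omega_j\zeta_j^p$ for $p\ge0$, where $\omega_j,\zeta_j\in\mathbb{C}$, $\omega_j\ne0$, and $\zeta_i\ne\zeta_j$ for $i\ne j$. Form $$H_0=(u_{a+b})_{a,b=0}^{r-1},\qquad H_1=(u_{a+b+1})_{a,b=0}^{r-1},\qquad V=(\zeta_j^a)_{0\le a\le r-1,\ 1\le j\le r},$$ $$A=H_0^{-1}H_1=V^{-T}\operatorname{diag}(\zeta_1,\dots,\zeta_r)V^T .$$ Let $\widehat H_0=H_0+E_0$ and $\widehat H_1=H_1+E_1$ with $E_0,E_1\in\mathbb{C}^{r\times r}$, and assume $$\eta_0=\|H_0^{-1}E_0\|_2<1 .$$ Then $\widehat H_0$ is invertible and, with $$\Delta_A=\frac{\|H_0^{-1}\|_2}{1-\eta_0}\big(\|E_1\|_2+\|E_0\|_2\|A\|_2\big),$$ every generalized eigenvalue $\widehat\zeta$ of the perturbed pencil $\widehat H_1x=\widehat\zeta\,\widehat H_0x$ satisfies $$\min_j|\widehat\zeta-\zeta_j|\le\kappa_2(V)\,\Delta_A .$$ If $\kappa_2(V)\Delta_A$ is smaller than one half of the minimum node separation $\min_{i\ne j}|\zeta_i-\zeta_j|$, then the perturbed nodes (the generalized eigenvalues of the perturbed pencil, counted with multiplicity) can be labeled so that each exact node $\zeta_j$ is matched with exactly one perturbed node inside its corresponding disk, i.e. the disk of radius $\kappa_2(V)\Delta_A$ centered at $\zeta_j$.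
   Context: $\|\cdot\|_2$ is the spectral norm, $\kappa_2(V)=\|V\|_2\|V^{-1}\|_2$, $V^T$ is the (non-conjugate) transpose and $V^{-T}=(V^T)^{-1}$. Convention: $\zeta^0=1$ for every $\zeta\in\mathbb{C}$; for $r=1$ the minimum node separation is taken to be $+\infty$. The disks are closed. *)

theory Defs
  imports
    "HOL-Analysis.L2_Norm"
    "HOL-Library.Extended_Real"
    "HOL-Computational_Algebra.Polynomial"
    "Jordan_Normal_Form.Determinant"
    "Jordan_Normal_Form.Gauss_Jordan_Elimination"
begin

text \<open>Matrices are of type \<open>complex mat\<close>, indexed from \<open>0\<close>; accordingly the nodes and weights
  are indexed by \<open>{..<r}\<close> instead of \<open>{1..r}\<close>. Note that \<open>0 ^ 0 = 1\<close> in HOL.\<close>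

text \<open>An unspecified value unless the argument is square and invertible.\<close>
abbreviation minv :: "complex mat \<Rightarrow> complex mat" where
  "minv A \<equiv> the (mat_inverse A)"

definition vec_l2norm :: "complex vec \<Rightarrow> real" where
  "vec_l2norm v = L2_set (\<lambda>i. cmod (v $ i)) {..<dim_vec v}"

text \<open>The operator norm induced by the Euclidean norms. The unit ball is used rather than the
  unit sphere so that the supremum is over a nonempty set even for a matrix without columns.\<close>
definition spectral_norm :: "complex mat \<Rightarrow> real" where
  "spectral_norm A =
     (SUP v \<in> {v \<in> carrier_vec (dim_col A). vec_l2norm v \<le> 1}. vec_l2norm (A *\<^sub>v v))"

definition cond2 :: "complex mat \<Rightarrow> real" where
  "cond2 V = spectral_norm V * spectral_norm (minv V)"

text \<open>With \<open>s = 0\<close> and \<open>s = 1\<close> this gives the Hankel matrices \<open>H\<^sub>0\<close> and \<open>H\<^sub>1\<close>.\<close>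
definition hankel_mat :: "nat \<Rightarrow> nat \<Rightarrow> (nat \<Rightarrow> complex) \<Rightarrow> complex mat" where
  "hankel_mat r s u = mat r r (\<lambda>(a, b). u (a + b + s))"

definition vandermonde_mat :: "nat \<Rightarrow> (nat \<Rightarrow> complex) \<Rightarrow> complex mat" where
  "vandermonde_mat r \<zeta> = mat r r (\<lambda>(a, j). \<zeta> j ^ a)"

text \<open>The infimum of the empty set is \<open>\<infinity>\<close>, which is the convention for \<open>r = 1\<close>.\<close>
definition node_sep :: "nat \<Rightarrow> (nat \<Rightarrow> complex) \<Rightarrow> ereal" where
  "node_sep r \<zeta> =
     (INF (i, j) \<in> {(i, j). i < r \<and> j < r \<and> i \<noteq> j}. ereal (cmod (\<zeta> i - \<zeta> j)))"

text \<open>Generalized eigenvalues of the pencil \<open>M x = z N x\<close>.\<close>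
definition gen_eigenvalue :: "complex mat \<Rightarrow> complex mat \<Rightarrow> complex \<Rightarrow> bool" where
  "gen_eigenvalue M N z \<longleftrightarrow>
     (\<exists>x \<in> carrier_vec (dim_col M). x \<noteq> 0\<^sub>v (dim_col M) \<and> M *\<^sub>v x = z \<cdot>\<^sub>v (N *\<^sub>v x))"

text \<open>The polynomial \<open>det (M - z N)\<close> in \<open>z\<close>. The multiplicity of a generalized eigenvalue is its
  multiplicity as a root of this polynomial.\<close>
definition pencil_poly :: "complex mat \<Rightarrow> complex mat \<Rightarrow> complex poly" where
  "pencil_poly M N =
     det (map_mat (\<lambda>c. [:c:]) M - [:0, 1:] \<cdot>\<^sub>m map_mat (\<lambda>c. [:c:]) N)"

definition gen_eigenvalues_mset :: "complex mat \<Rightarrow> complex mat \<Rightarrow> complex multiset" where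
  "gen_eigenvalues_mset M N = proots (pencil_poly M N)"

end

theory Submission
  imports Defs
    "Jordan_Normal_Form.Char_Poly"
    "HOL-Computational_Algebra.Fundamental_Theorem_Algebra"
    "HOL-Analysis.Topology_Euclidean_Space"
begin

text \<open>
  Write \<open>D = diag(\<zeta>\<^sub>0, \<dots>, \<zeta>\<^sub>r\<^sub>-\<^sub>1)\<close>. The Hankel matrices factor as \<open>H\<^sub>0 = V diag(\<omega>) V\<^sup>T\<close> and
  \<open>H\<^sub>1 = V diag(\<omega>) D V\<^sup>T\<close>, and \<open>V\<close> is invertible because a nonzero polynomial of degree less than
  \<open>r\<close> cannot vanish at \<open>r\<close> distinct nodes. As no weight vanishes, \<open>H\<^sub>0\<close> is invertible too, and
  \<open>A = V\<^sup>-\<^sup>T D V\<^sup>T\<close> is diagonalised by \<open>V\<^sup>T\<close>.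

  If \<open>w\<close> is any vector, then \<open>w = H\<^sub>0\<^sup>-\<^sup>1 (H\<^sub>0 + E\<^sub>0) w - H\<^sub>0\<^sup>-\<^sup>1 E\<^sub>0 w\<close>, so that
  \<open>(1 - \<eta>\<^sub>0) \<parallel>w\<parallel> \<le> \<parallel>H\<^sub>0\<^sup>-\<^sup>1\<parallel> \<parallel>(H\<^sub>0 + E\<^sub>0) w\<parallel>\<close>. This single estimate gives the invertibility of
  \<open>H\<^sub>0 + E\<^sub>0\<close> and, for \<open>B = (H\<^sub>0 + E\<^sub>0)\<^sup>-\<^sup>1 (H\<^sub>1 + E\<^sub>1)\<close>, the bound \<open>\<parallel>B - A\<parallel> \<le> \<Delta>\<^sub>A\<close>, since
  \<open>(H\<^sub>0 + E\<^sub>0) (B - A) = E\<^sub>1 - E\<^sub>0 A\<close>. The generalized eigenvalues of the perturbed pencil are the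
  eigenvalues of \<open>B\<close>, with the same multiplicities, so the Bauer-Fike theorem (\<open>bauer_fike\<close>)
  places them in the disks of radius \<open>\<kappa>\<^sub>2(V) \<Delta>\<^sub>A\<close> around the nodes.

  For the matching, the same theorem applies to \<open>A + t (B - A)\<close> for every \<open>t \<in> [0, 1]\<close>: along this
  segment no eigenvalue ever leaves the union of the disks. When the disks are disjoint, an
  eigenvalue would have to jump in order to change disks, so the number of eigenvalues in each
  disk is constant in \<open>t\<close> (\<open>root_count_constant\<close>). At \<open>t = 0\<close> it is one, hence also at \<open>t = 1\<close>.
  The constancy comes from compactness: limits of roots are roots of the limit, so each set of
  parameters with a prescribed count is closed, and the parameter interval is connected.
\<close>

section \<open>Constancy of root counts along a connected family\<close>

text \<open>
  Sequential compactness of a finite product of compact sets. It will be applied to labelled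
  tuples of roots.
\<close>

lemma compact_family_convergent_subsequence:
  fixes f :: "nat \<Rightarrow> nat \<Rightarrow> 'a::metric_space"
  assumes "\<And>i. i < n \<Longrightarrow> compact (C i)"
    and "\<And>m i. i < n \<Longrightarrow> f m i \<in> C i"
  shows "\<exists>l \<sigma>. strict_mono (\<sigma> :: nat \<Rightarrow> nat) \<and>
           (\<forall>i<n. l i \<in> C i \<and> (\<lambda>m. f (\<sigma> m) i) \<longlonglongrightarrow> l i)"
  using assms
proof (induction n)
  case 0
  show ?case by (auto intro: exI[of _ id] simp: strict_mono_id)
next
  case (Suc n)
  then obtain l \<sigma> where \<sigma>: "strict_mono \<sigma>"
    and l: "\<And>i. i < n \<Longrightarrow> l i \<in> C i \<and> (\<lambda>m. f (\<sigma> m) i) \<longlonglongrightarrow> l i"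
    by (metis less_Suc_eq)
  have "seq_compact (C n)"
    using Suc.prems(1)[of n] by (simp add: compact_imp_seq_compact)
  then obtain c \<tau> where c: "c \<in> C n" and \<tau>: "strict_mono \<tau>"
    and lim: "((\<lambda>m. f (\<sigma> m) n) \<circ> \<tau>) \<longlonglongrightarrow> c"
    using Suc.prems(2)[of n] by (metis seq_compactE lessI)
  have "(l(n := c)) i \<in> C i \<and> (\<lambda>m. f ((\<sigma> \<circ> \<tau>) m) i) \<longlonglongrightarrow> (l(n := c)) i"
    if "i < Suc n" for i
  proof (cases "i = n")
    case True
    then show ?thesis using c lim by (simp add: o_def)
  next
    case False
    then have "i < n" using that by simp
    then show ?thesis
      using l[of i] LIMSEQ_subseq_LIMSEQ[OF _ \<tau>, of "\<lambda>m. f (\<sigma> m) i" "l i"] by (simp add: o_def)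
  qed
  then show ?case using strict_mono_o[OF \<sigma> \<tau>] by blast
qed

lemma proots_prod_linear_factors:
  fixes f :: "nat \<Rightarrow> complex"
  shows "proots (\<Prod>i<n. [:- f i, 1:]) = image_mset f (mset_set {..<n})"
proof -
  have "proots (\<Prod>i<n. [:- f i, 1:]) = (\<Sum>i<n. {#f i#})"
    by (subst proots_prod) auto
  also have "\<dots> = image_mset f (mset_set {..<n})"
    by (induction n) (auto simp: lessThan_Suc)
  finally show ?thesis .
qed

text \<open>
  Listing first the roots in \<open>K\<close> turns the count of roots in \<open>K\<close> into a condition on each
  label separately, which survives the passage to limits.
\<close>

lemma monic_complex_poly_factors_sorted:
  fixes p :: "complex poly" and K :: "complex set"
  assumes "lead_coeff p = 1"
  defines "k \<equiv> size (filter_mset (\<lambda>z. z \<in> K) (proots p))"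
  shows "k \<le> degree p \<and>
    (\<exists>f. p = (\<Prod>i<degree p. [:- f i, 1:]) \<and> (\<forall>i<degree p. f i \<in> K \<longleftrightarrow> i < k))"
proof -
  obtain ys where ys: "mset ys = filter_mset (\<lambda>z. z \<in> K) (proots p)"
    using ex_mset by blast
  obtain zs where zs: "mset zs = filter_mset (\<lambda>z. z \<notin> K) (proots p)"
    using ex_mset by blast
  let ?xs = "ys @ zs"
  have xs: "mset ?xs = proots p"
    by (simp add: ys zs flip: multiset_partition)
  have len: "length ?xs = degree p"
    by (metis xs size_mset size_proots_complex)
  have lys: "length ys = k"
    by (metis ys size_mset k_def)
  have "p = (\<Prod>x\<in>#proots p. [:-x, 1:])"
    using complex_poly_decompose_multiset[of p] assms(1) by simp
  also have "\<dots> = prod_list (map (\<lambda>x. [:-x, 1:]) ?xs)"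
    by (metis xs mset_map prod_mset_prod_list)
  also have "\<dots> = (\<Prod>i<degree p. [:- ?xs ! i, 1:])"
    unfolding prod.list_conv_set_nth
    using len by (intro prod.cong) (auto simp: atLeast0LessThan simp del: map_append)
  finally have 1: "p = (\<Prod>i<degree p. [:- ?xs ! i, 1:])" .
  have "set ys \<subseteq> K" "set zs \<inter> K = {}"
    using arg_cong[OF ys, of set_mset] arg_cong[OF zs, of set_mset] by auto
  then have "?xs ! i \<in> K \<longleftrightarrow> i < k" if "i < degree p" for i
  proof (cases "i < k")
    case True
    then show ?thesis using \<open>set ys \<subseteq> K\<close> lys nth_mem[of i ys] by (auto simp: nth_append)
  next
    case False
    then have "zs ! (i - k) \<in> set zs" using that lys len by (intro nth_mem) auto
    then show ?thesis using False \<open>set zs \<inter> K = {}\<close> lys by (auto simp: nth_append)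
  qed
  then have "\<exists>f. p = (\<Prod>i<degree p. [:- f i, 1:]) \<and> (\<forall>i<degree p. f i \<in> K \<longleftrightarrow> i < k)"
    using 1 by (intro exI[of _ "(!) ?xs"]) auto
  moreover have "k \<le> degree p" using lys len by auto
  ultimately show ?thesis by blast
qed

text \<open>
  The roots are confined to two disjoint compact sets. A limit of parameters with exactly \<open>k\<close>
  roots in \<open>K\<close> again has \<open>k\<close> roots there: choose labellings with the first \<open>k\<close> roots in \<open>K\<close> and
  the others in \<open>L\<close>, pass to a subsequence along which all labelled roots converge, and compare
  the limit of the polynomials with the product of the limiting linear factors. So \<open>T\<close> is a
  finite disjoint union of closed sets, one for each count, and by connectedness only one of
  them is nonempty.
\<close>

lemma root_count_constant:
  fixes p :: "'a::metric_space \<Rightarrow> complex poly"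
  assumes "connected T" "closed T"
    and K: "compact K" "compact L" "K \<inter> L = {}"
    and deg: "\<And>t. t \<in> T \<Longrightarrow> degree (p t) = n"
    and monic: "\<And>t. t \<in> T \<Longrightarrow> lead_coeff (p t) = 1"
    and cont: "\<And>z. continuous_on T (\<lambda>t. poly (p t) z)"
    and roots: "\<And>t z. t \<in> T \<Longrightarrow> poly (p t) z = 0 \<Longrightarrow> z \<in> K \<union> L"
    and st: "s \<in> T" "t \<in> T"
  shows "size (filter_mset (\<lambda>z. z \<in> K) (proots (p s)))
       = size (filter_mset (\<lambda>z. z \<in> K) (proots (p t)))"
proof -
  define N where "N t = size (filter_mset (\<lambda>z. z \<in> K) (proots (p t)))" for t
  define S where "S k = {t \<in> T. \<exists>f. p t = (\<Prod>i<n. [:- f i, 1:]) \<and>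
    (\<forall>i<n. f i \<in> (if i < k then K else L))}" for k
  have S_count: "N t = k" if tS: "t \<in> S k" and "k \<le> n" for t k
  proof -
    obtain f where f: "p t = (\<Prod>i<n. [:- f i, 1:])"
      and fK: "\<And>i. i < n \<Longrightarrow> f i \<in> (if i < k then K else L)"
      using tS unfolding S_def by blast
    have "N t = size (filter_mset (\<lambda>i. f i \<in> K) (mset_set {..<n}))"
      by (simp add: N_def f proots_prod_linear_factors filter_mset_image_mset)
    also have "\<dots> = card {i \<in> {..<n}. f i \<in> K}"
      by (simp add: filter_mset_mset_set)
    also have "{i \<in> {..<n}. f i \<in> K} = {..<k}"
    proof -
      have "f i \<in> K \<longleftrightarrow> i < k" if "i < n" for i
        using fK[OF that] K(3) by (auto split: if_splits)
      then show ?thesis using \<open>k \<le> n\<close> by auto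
    qed
    finally show ?thesis by simp
  qed
  have in_S: "N t \<le> n \<and> t \<in> S (N t)" if tT: "t \<in> T" for t
  proof -
    obtain f where f: "p t = (\<Prod>i<n. [:- f i, 1:])" "\<And>i. i < n \<Longrightarrow> f i \<in> K \<longleftrightarrow> i < N t"
      and le: "N t \<le> n"
      using monic_complex_poly_factors_sorted[OF monic[OF tT], of K] deg[OF tT]
      unfolding N_def by auto
    have "f i \<in> K \<union> L" if "i < n" for i
    proof (rule roots[OF \<open>t \<in> T\<close>])
      show "poly (p t) (f i) = 0"
        unfolding f(1) poly_prod using that by (intro prod_zero bexI[of _ i]) auto
    qed
    then have "\<forall>i<n. f i \<in> (if i < N t then K else L)" using f(2) by auto
    then show ?thesis using f(1) le tT unfolding S_def by blast
  qed
  have closed_S: "closed (S k)" for k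
    unfolding closed_sequential_limits
  proof (intro allI impI)
    fix x l assume "(\<forall>m. x m \<in> S k) \<and> x \<longlonglongrightarrow> l"
    then have x: "\<And>m. x m \<in> S k" and lim: "x \<longlonglongrightarrow> l" by auto
    have xT: "\<And>m. x m \<in> T" using x by (auto simp: S_def)
    then have lT: "l \<in> T" using \<open>closed T\<close> lim closed_sequential_limits by blast
    have "\<forall>m. \<exists>f. p (x m) = (\<Prod>i<n. [:- f i, 1:]) \<and> (\<forall>i<n. f i \<in> (if i < k then K else L))"
      using x unfolding S_def by blast
    then obtain f where f: "\<And>m. p (x m) = (\<Prod>i<n. [:- f m i, 1:])"
      and fK: "\<And>m i. i < n \<Longrightarrow> f m i \<in> (if i < k then K else L)"
      by metis
    have "compact (if i < k then K else L)" for i using K by simp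
    then have "\<exists>g \<sigma>. strict_mono (\<sigma> :: nat \<Rightarrow> nat) \<and>
        (\<forall>i<n. g i \<in> (if i < k then K else L) \<and> (\<lambda>m. f (\<sigma> m) i) \<longlonglongrightarrow> g i)"
      using fK by (intro compact_family_convergent_subsequence)
    then obtain g \<sigma> where \<sigma>: "strict_mono \<sigma>"
      and g: "\<And>i. i < n \<Longrightarrow> g i \<in> (if i < k then K else L)"
      and fg: "\<And>i. i < n \<Longrightarrow> (\<lambda>m. f (\<sigma> m) i) \<longlonglongrightarrow> g i"
      by blast
    have "poly (p l) z = poly (\<Prod>i<n. [:- g i, 1:]) z" for z
    proof (rule LIMSEQ_unique)
      have "(\<lambda>m. x (\<sigma> m)) \<longlonglongrightarrow> l"
        using LIMSEQ_subseq_LIMSEQ[OF lim \<sigma>] by (simp add: o_def)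
      then show "(\<lambda>m. poly (p (x (\<sigma> m))) z) \<longlonglongrightarrow> poly (p l) z"
        by (rule continuous_on_tendsto_compose[OF cont]) (use lT xT in auto)
      show "(\<lambda>m. poly (p (x (\<sigma> m))) z) \<longlonglongrightarrow> poly (\<Prod>i<n. [:- g i, 1:]) z"
        unfolding f poly_prod by (intro tendsto_prod) (auto intro!: tendsto_intros fg)
    qed
    then have "p l = (\<Prod>i<n. [:- g i, 1:])" by (simp add: fun_eq_iff flip: poly_eq_poly_eq_iff)
    then show "l \<in> S k" using g lT unfolding S_def by blast
  qed
  define U where "U = (\<Union>k\<in>{..n} - {N s}. S k)"
  have U: "closed U" unfolding U_def using closed_S by (intro closed_UN) auto
  \<comment> \<open>If the counts differed, \<open>S (N s)\<close> and \<open>U\<close> would disconnect \<open>T\<close>.\<close>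
  have "N t = N s"
  proof (rule ccontr)
    assume "N t \<noteq> N s"
    then have "t \<in> U" using in_S[OF st(2)] by (auto simp: U_def)
    moreover have "T \<subseteq> S (N s) \<union> U"
    proof
      fix x assume "x \<in> T"
      then show "x \<in> S (N s) \<union> U" using in_S[of x] by (cases "N x = N s") (auto simp: U_def)
    qed
    moreover have "S (N s) \<inter> U \<inter> T = {}"
      using S_count in_S[OF st(1)] by (auto simp: U_def)
    ultimately show False
      using \<open>connected T\<close> closed_S U st in_S[OF st(1)] unfolding connected_closed by blast
  qed
  then show ?thesis by (simp add: N_def)
qed

section \<open>Euclidean norm and spectral norm\<close>

lemma vec_l2norm_nonneg [simp]: "0 \<le> vec_l2norm v"
  by (simp add: vec_l2norm_def)

lemma vec_l2norm_eq_0: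
  "v \<in> carrier_vec n \<Longrightarrow> vec_l2norm v = 0 \<longleftrightarrow> v = 0\<^sub>v n"
  by (auto simp: vec_l2norm_def L2_set_eq_0_iff)

lemma vec_l2norm_smult: "vec_l2norm (c \<cdot>\<^sub>v v) = cmod c * vec_l2norm v"
proof -
  have "vec_l2norm (c \<cdot>\<^sub>v v) = L2_set (\<lambda>i. cmod c * cmod (v $ i)) {..<dim_vec v}"
    unfolding vec_l2norm_def by (intro L2_set_cong) (auto simp: norm_mult)
  then show ?thesis by (simp add: L2_set_right_distrib vec_l2norm_def)
qed

lemma vec_l2norm_triangle:
  assumes "v \<in> carrier_vec n" "w \<in> carrier_vec n"
  shows "vec_l2norm (v + w) \<le> vec_l2norm v + vec_l2norm w"
proof -
  have "vec_l2norm (v + w) \<le> L2_set (\<lambda>i. cmod (v $ i) + cmod (w $ i)) {..<n}"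
    unfolding vec_l2norm_def using assms by (auto intro!: L2_set_mono norm_triangle_ineq)
  also have "\<dots> \<le> vec_l2norm v + vec_l2norm w"
    using L2_set_triangle_ineq[of "\<lambda>i. cmod (v $ i)" "\<lambda>i. cmod (w $ i)" "{..<n}"] assms
    by (simp add: vec_l2norm_def)
  finally show ?thesis .
qed

lemma vec_l2norm_diff:
  assumes "v \<in> carrier_vec n" "w \<in> carrier_vec n"
  shows "vec_l2norm (v - w) \<le> vec_l2norm v + vec_l2norm w"
proof -
  have "v - w = v + (-1) \<cdot>\<^sub>v w" using assms by (intro eq_vecI) auto
  then show ?thesis
    using vec_l2norm_triangle[of v n "(-1) \<cdot>\<^sub>v w"] assms by (simp add: vec_l2norm_smult)
qed

text \<open>
  Without boundedness the supremum that defines the norm would be an arbitrary value. The sum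
  of the moduli of the entries is a crude bound that suffices.
\<close>

lemma spectral_norm_bdd_above:
  "bdd_above ((\<lambda>v. vec_l2norm (A *\<^sub>v v)) ` {v \<in> carrier_vec (dim_col A). vec_l2norm v \<le> 1})"
proof (rule bdd_aboveI2)
  fix v assume v: "v \<in> {v \<in> carrier_vec (dim_col A). vec_l2norm v \<le> 1}"
  have entry: "cmod (v $ j) \<le> 1" if "j < dim_col A" for j
    using member_le_L2_set[of "{..<dim_col A}" j "\<lambda>i. cmod (v $ i)"] v that
    by (auto simp: vec_l2norm_def)
  have "vec_l2norm (A *\<^sub>v v) \<le> (\<Sum>i<dim_row A. cmod ((A *\<^sub>v v) $ i))"
    unfolding vec_l2norm_def by (auto intro: order_trans[OF L2_set_le_sum])
  also have "\<dots> \<le> (\<Sum>i<dim_row A. \<Sum>j<dim_col A. cmod (A $$ (i, j)))"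
  proof (rule sum_mono)
    fix i assume i: "i \<in> {..<dim_row A}"
    have "(A *\<^sub>v v) $ i = (\<Sum>j<dim_col A. A $$ (i, j) * v $ j)"
      using i v by (auto simp: scalar_prod_def atLeast0LessThan)
    also have "cmod \<dots> \<le> (\<Sum>j<dim_col A. cmod (A $$ (i, j)))"
      by (rule sum_norm_le) (auto simp: norm_mult entry mult_left_le)
    finally show "cmod ((A *\<^sub>v v) $ i) \<le> (\<Sum>j<dim_col A. cmod (A $$ (i, j)))" .
  qed
  finally show "vec_l2norm (A *\<^sub>v v) \<le> (\<Sum>i<dim_row A. \<Sum>j<dim_col A. cmod (A $$ (i, j)))" .
qed

lemma spectral_norm_nonneg [simp]: "0 \<le> spectral_norm A"
proof -
  have "vec_l2norm (A *\<^sub>v 0\<^sub>v (dim_col A)) \<le> spectral_norm A"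
    unfolding spectral_norm_def
    by (rule cSUP_upper[OF _ spectral_norm_bdd_above]) (simp add: vec_l2norm_def L2_set_0')
  then show ?thesis using vec_l2norm_nonneg order_trans by blast
qed

lemma vec_l2norm_mult_mat_vec:
  assumes "A \<in> carrier_mat m n" "v \<in> carrier_vec n"
  shows "vec_l2norm (A *\<^sub>v v) \<le> spectral_norm A * vec_l2norm v"
proof (cases "vec_l2norm v = 0")
  case True
  then have "v = 0\<^sub>v n" using assms vec_l2norm_eq_0 by blast
  then have "A *\<^sub>v v = 0\<^sub>v m" using assms by auto
  then show ?thesis using True by (simp add: vec_l2norm_def L2_set_0')
next
  case False
  let ?c = "complex_of_real (vec_l2norm v)"
  let ?w = "inverse ?c \<cdot>\<^sub>v v"
  have v: "v = ?c \<cdot>\<^sub>v ?w" using False by (simp add: smult_smult_assoc)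
  have w: "?w \<in> carrier_vec n" using assms by simp
  have "vec_l2norm ?w = 1"
    using False by (simp add: vec_l2norm_smult norm_inverse)
  then have "vec_l2norm (A *\<^sub>v ?w) \<le> spectral_norm A"
    unfolding spectral_norm_def using assms
    by (intro cSUP_upper[OF _ spectral_norm_bdd_above]) auto
  moreover have "A *\<^sub>v v = ?c \<cdot>\<^sub>v (A *\<^sub>v ?w)"
    using v mult_mat_vec[OF assms(1) w] by metis
  ultimately show ?thesis
    by (metis mult.commute mult_left_mono norm_of_real abs_of_nonneg vec_l2norm_nonneg vec_l2norm_smult)
qed

lemma spectral_norm_le:
  assumes "A \<in> carrier_mat m n" "0 \<le> c"
    and "\<And>v. v \<in> carrier_vec n \<Longrightarrow> vec_l2norm (A *\<^sub>v v) \<le> c * vec_l2norm v"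
  shows "spectral_norm A \<le> c"
  unfolding spectral_norm_def
proof (rule cSUP_least)
  show "{v \<in> carrier_vec (dim_col A). vec_l2norm v \<le> 1} \<noteq> {}"
    by (auto intro!: exI[of _ "0\<^sub>v (dim_col A)"] simp: vec_l2norm_def L2_set_0')
  fix v assume "v \<in> {v \<in> carrier_vec (dim_col A). vec_l2norm v \<le> 1}"
  then show "vec_l2norm (A *\<^sub>v v) \<le> c"
    using assms by (auto intro: order_trans mult_left_le)
qed

lemma vec_l2norm_conjugate: "vec_l2norm (conjugate v) = vec_l2norm v"
  unfolding vec_l2norm_def by (intro L2_set_cong) auto

lemma vec_l2norm_power2:
  "complex_of_real ((vec_l2norm v)\<^sup>2) = conjugate v \<bullet> v"
proof -
  have "conjugate v \<bullet> v = (\<Sum>i<dim_vec v. complex_of_real ((cmod (v $ i))\<^sup>2))"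
    by (auto simp: scalar_prod_def atLeast0LessThan complex_norm_square mult.commute simp del: of_real_power intro!: sum.cong)
  then show ?thesis
    by (simp add: vec_l2norm_def L2_set_def sum_nonneg del: of_real_power)
qed

lemma scalar_prod_cauchy_schwarz:
  assumes "v \<in> carrier_vec n" "w \<in> carrier_vec n"
  shows "cmod (v \<bullet> w) \<le> vec_l2norm v * vec_l2norm w"
proof -
  have "cmod (v \<bullet> w) \<le> (\<Sum>i<n. \<bar>cmod (v $ i)\<bar> * \<bar>cmod (w $ i)\<bar>)"
    using assms by (auto simp: scalar_prod_def atLeast0LessThan norm_mult intro!: sum_norm_le)
  also have "\<dots> \<le> vec_l2norm v * vec_l2norm w"
    using L2_set_mult_ineq[of "\<lambda>i. cmod (v $ i)" "\<lambda>i. cmod (w $ i)" "{..<n}"] assms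
    by (simp add: vec_l2norm_def)
  finally show ?thesis .
qed

text \<open>
  With \<open>w = A\<^sup>T v\<close> one has \<open>\<parallel>w\<parallel>\<^sup>2 = v \<bullet> (A w\<^sup>*)\<close>, where \<open>w\<^sup>*\<close> is the entrywise conjugate and
  \<open>\<bullet>\<close> is bilinear; the inequality of Cauchy and Schwarz then cancels one factor \<open>\<parallel>w\<parallel>\<close>. This is
  what lets \<open>\<kappa>\<^sub>2(V)\<close> control a diagonalisation by \<open>V\<^sup>T\<close>.
\<close>

lemma spectral_norm_transpose_le:
  assumes A: "A \<in> carrier_mat m n"
  shows "spectral_norm (transpose_mat A) \<le> spectral_norm A"
proof (rule spectral_norm_le)
  show "transpose_mat A \<in> carrier_mat n m" using A by simp
  show "0 \<le> spectral_norm A" by simp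
  fix v :: "complex Matrix.vec" assume v: "v \<in> carrier_vec m"
  let ?w = "transpose_mat A *\<^sub>v v"
  have w: "?w \<in> carrier_vec n" "conjugate ?w \<in> carrier_vec n" using A v by auto
  have "complex_of_real ((vec_l2norm ?w)\<^sup>2) = ?w \<bullet> conjugate ?w"
    using w by (metis vec_l2norm_power2 comm_scalar_prod)
  also have "\<dots> = v \<bullet> (A *\<^sub>v conjugate ?w)"
    using transpose_vec_mult_scalar[of A m n "conjugate ?w" v] A v w by simp
  finally have "(vec_l2norm ?w)\<^sup>2 = cmod (v \<bullet> (A *\<^sub>v conjugate ?w))"
    by (metis norm_of_real abs_of_nonneg zero_le_power2)
  also have "\<dots> \<le> vec_l2norm v * vec_l2norm (A *\<^sub>v conjugate ?w)"
    using A v w by (intro scalar_prod_cauchy_schwarz[of _ m]) auto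
  also have "\<dots> \<le> vec_l2norm v * (spectral_norm A * vec_l2norm ?w)"
    using vec_l2norm_mult_mat_vec[OF A w(2)] by (simp add: mult_left_mono vec_l2norm_conjugate)
  finally have "vec_l2norm ?w * vec_l2norm ?w \<le> (spectral_norm A * vec_l2norm v) * vec_l2norm ?w"
    by (simp add: power2_eq_square mult_ac)
  then show "vec_l2norm ?w \<le> spectral_norm A * vec_l2norm v"
    by (cases "vec_l2norm ?w = 0") (auto simp: less_le)
qed

section \<open>Inverses\<close>

lemma det_nonzero_if_trivial_kernel:
  fixes A :: "complex mat"
  assumes "A \<in> carrier_mat n n"
    and "\<And>v. v \<in> carrier_vec n \<Longrightarrow> A *\<^sub>v v = 0\<^sub>v n \<Longrightarrow> v = 0\<^sub>v n"
  shows "det A \<noteq> 0"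
  using assms det_0_iff_vec_prod_zero[OF assms(1)] by blast

lemma minv_inverse:
  assumes A: "A \<in> carrier_mat n n" and "det A \<noteq> 0"
  shows "minv A \<in> carrier_mat n n" "A * minv A = 1\<^sub>m n" "minv A * A = 1\<^sub>m n"
    "invertible_mat A"
proof -
  have "A \<in> Units (ring_mat TYPE(complex) n ())"
    using assms by (rule det_non_zero_imp_unit)
  then obtain B where "mat_inverse A = Some B"
    using mat_inverse(1)[OF A] by fastforce
  then show *: "minv A \<in> carrier_mat n n" "A * minv A = 1\<^sub>m n" "minv A * A = 1\<^sub>m n"
    using mat_inverse(2)[OF A] by auto
  then show "invertible_mat A"
    using A by (auto simp: invertible_mat_def inverts_mat_def intro!: exI[of _ "minv A"])
qed

lemma minv_eqI:
  assumes A: "A \<in> carrier_mat n n" and B: "B \<in> carrier_mat n n" and BA: "B * A = 1\<^sub>m n"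
  shows "minv A = B"
proof -
  have d: "det A \<noteq> 0" using det_mult[OF B A] by (auto simp: BA)
  note m = minv_inverse[OF A d]
  have "minv A = (B * A) * minv A" using m by (simp add: BA)
  also have "\<dots> = B" using A B m by (subst assoc_mult_mat[OF B A m(1)]) simp
  finally show ?thesis .
qed

lemma minv_transpose:
  assumes A: "A \<in> carrier_mat n n" and d: "det A \<noteq> 0"
  shows "minv (transpose_mat A) = transpose_mat (minv A)"
  using minv_inverse[OF A d] A
  by (intro minv_eqI[of _ n]) (auto simp: transpose_mult[symmetric])

lemma det_mat_diag_nonzero:
  fixes f :: "nat \<Rightarrow> complex"
  assumes "\<And>i. i < r \<Longrightarrow> f i \<noteq> 0"
  shows "det (mat_diag r f) \<noteq> 0"
proof -
  have "mat_diag r f * mat_diag r (\<lambda>i. inverse (f i)) = 1\<^sub>m r"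
    unfolding mat_diag_diag using assms by (intro eq_matI) (auto simp: mat_diag_def)
  then show ?thesis
    using det_mult[OF mat_diag_dim[of r f] mat_diag_dim[of r "\<lambda>i. inverse (f i)"]] by auto
qed

section \<open>Hankel and Vandermonde matrices\<close>

text \<open>
  A vector \<open>c\<close> in the kernel of the transpose is the coefficient vector of a polynomial of degree
  less than \<open>r\<close> that vanishes at all \<open>r\<close> nodes.
\<close>

lemma det_vandermonde_mat:
  assumes "inj_on \<zeta> {..<r}"
  shows "det (vandermonde_mat r \<zeta>) \<noteq> 0"
proof -
  let ?V = "vandermonde_mat r \<zeta>"
  have "det (transpose_mat ?V) \<noteq> 0"
  proof (rule det_nonzero_if_trivial_kernel)
    show "transpose_mat ?V \<in> carrier_mat r r" by (simp add: vandermonde_mat_def)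
    fix c assume c: "c \<in> carrier_vec r" "transpose_mat ?V *\<^sub>v c = 0\<^sub>v r"
    define q where "q = (\<Sum>a<r. monom (c $ a) a)"
    have coeff: "coeff q a = (if a < r then c $ a else 0)" for a
      by (simp add: q_def coeff_sum)
    have "poly q (\<zeta> j) = 0" if "j < r" for j
    proof -
      have "poly q (\<zeta> j) = (transpose_mat ?V *\<^sub>v c) $ j"
        using that c(1) by (auto simp: q_def poly_sum poly_monom vandermonde_mat_def scalar_prod_def
            atLeast0LessThan mult.commute intro!: sum.cong)
      then show ?thesis using that by (simp add: c(2))
    qed
    then have sub: "\<zeta> ` {..<r} \<subseteq> {z. poly q z = 0}" by auto
    have "q = 0"
    proof (rule ccontr)
      assume q: "q \<noteq> 0"
      have "r = card (\<zeta> ` {..<r})" using assms by (simp add: card_image)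
      also have "\<dots> \<le> card {z. poly q z = 0}" using sub poly_roots_finite[OF q] by (rule card_mono[rotated])
      also have "\<dots> \<le> degree q" using q by (rule card_poly_roots_bound)
      finally have "coeff q (degree q) = 0" by (simp add: coeff)
      then show False using q by simp
    qed
    then show "c = 0\<^sub>v r" using coeff c(1) by (intro eq_vecI) (auto, metis coeff_0)
  qed
  then show ?thesis by (subst (asm) det_transpose[of _ r]) (auto simp: vandermonde_mat_def)
qed

lemma hankel_mat_factorization:
  assumes "\<And>p. u p = (\<Sum>j<r. \<omega> j * \<zeta> j ^ p)"
  shows "hankel_mat r s u =
    vandermonde_mat r \<zeta> * mat_diag r (\<lambda>j. \<omega> j * \<zeta> j ^ s) * transpose_mat (vandermonde_mat r \<zeta>)"
  by (subst mat_diag_mult_right[of _ r], simp add: vandermonde_mat_def, rule eq_matI)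
    (auto simp: hankel_mat_def vandermonde_mat_def scalar_prod_def assms atLeast0LessThan
       power_add mult_ac intro!: sum.cong)

text \<open>
  Cancelling \<open>V diag(\<omega>)\<close> between the two factorizations leaves the diagonalisation of
  \<open>H\<^sub>0\<^sup>-\<^sup>1 H\<^sub>1\<close>.
\<close>

lemma hankel_mat_quotient:
  assumes inj: "inj_on \<zeta> {..<r}" and \<omega>: "\<And>j. j < r \<Longrightarrow> \<omega> j \<noteq> 0"
    and u: "\<And>p. u p = (\<Sum>j<r. \<omega> j * \<zeta> j ^ p)"
  defines "V \<equiv> vandermonde_mat r \<zeta>"
  shows "det (hankel_mat r 0 u) \<noteq> 0"
    and "minv (hankel_mat r 0 u) * hankel_mat r 1 u =
         minv (transpose_mat V) * mat_diag r \<zeta> * transpose_mat V"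
proof -
  let ?H0 = "hankel_mat r 0 u" and ?W = "mat_diag r \<omega>" and ?Y = "transpose_mat V"
    and ?D = "mat_diag r \<zeta>"
  have V: "V \<in> carrier_mat r r" by (simp add: V_def vandermonde_mat_def)
  have Y: "?Y \<in> carrier_mat r r" using V by simp
  have dV: "det V \<noteq> 0" unfolding V_def by (rule det_vandermonde_mat[OF inj])
  have dY: "det ?Y \<noteq> 0" using det_transpose[OF V] dV by simp
  have W: "?W \<in> carrier_mat r r" and D: "?D \<in> carrier_mat r r" by simp_all
  have H0: "?H0 \<in> carrier_mat r r" by (simp add: hankel_mat_def)
  have H0_eq: "?H0 = V * ?W * ?Y"
    using hankel_mat_factorization[OF u, of 0] by (simp add: V_def)
  have VW: "V * ?W \<in> carrier_mat r r" using V W by simp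
  have H1_eq: "hankel_mat r 1 u = V * ?W * (?D * ?Y)"
  proof -
    have "hankel_mat r 1 u = V * (?W * ?D) * ?Y"
      using hankel_mat_factorization[OF u, of 1] by (simp add: V_def)
    also have "V * (?W * ?D) = V * ?W * ?D" by (rule assoc_mult_mat[OF V W D, symmetric])
    also have "V * ?W * ?D * ?Y = V * ?W * (?D * ?Y)" by (rule assoc_mult_mat[OF VW D Y])
    finally show ?thesis .
  qed
  show d0: "det ?H0 \<noteq> 0"
    unfolding H0_eq det_mult[OF VW Y] det_mult[OF V W] using dV dY det_mat_diag_nonzero[OF \<omega>] by simp
  note X = minv_inverse[OF Y dY] and I = minv_inverse[OF H0 d0]
  have DY: "?D * ?Y \<in> carrier_mat r r" using D Y by (rule mult_carrier_mat)
  have XDY: "minv ?Y * (?D * ?Y) \<in> carrier_mat r r" using X DY by simp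
  have "?H0 * (minv ?Y * (?D * ?Y)) = V * ?W * (?Y * (minv ?Y * (?D * ?Y)))"
    unfolding H0_eq by (rule assoc_mult_mat[OF VW Y XDY])
  also have "?Y * (minv ?Y * (?D * ?Y)) = ?D * ?Y"
    using assoc_mult_mat[OF Y X(1) DY] X(2) DY by (metis left_mult_one_mat)
  finally have "hankel_mat r 1 u = ?H0 * (minv ?Y * (?D * ?Y))" by (simp only: H1_eq)
  then have "minv ?H0 * hankel_mat r 1 u = minv ?H0 * ?H0 * (minv ?Y * (?D * ?Y))"
    using assoc_mult_mat[OF I(1) H0 XDY] by (simp only:)
  also have "\<dots> = minv ?Y * (?D * ?Y)" unfolding I(3) by (rule left_mult_one_mat[OF XDY])
  also have "\<dots> = minv ?Y * ?D * ?Y" by (rule assoc_mult_mat[OF X(1) D Y, symmetric])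
  finally show "minv ?H0 * hankel_mat r 1 u = minv ?Y * ?D * ?Y" .
qed

section \<open>Perturbation of a diagonalisable matrix\<close>

lemma diag_shift_lower_bound:
  assumes y: "y \<in> carrier_vec r" and gap: "\<And>j. j < r \<Longrightarrow> d \<le> cmod (z - \<zeta> j)" and "0 \<le> d"
  shows "d * vec_l2norm y \<le> vec_l2norm (z \<cdot>\<^sub>v y - mat_diag r \<zeta> *\<^sub>v y)"
proof -
  have ent: "(z \<cdot>\<^sub>v y - mat_diag r \<zeta> *\<^sub>v y) $ i = (z - \<zeta> i) * y $ i" if "i < r" for i
  proof -
    have "(mat_diag r \<zeta> *\<^sub>v y) $ i = \<zeta> i * y $ i"
      using y that by (simp add: mat_diag_def scalar_prod_def atLeast0LessThan if_distrib[where f="\<lambda>x. x * _"] cong: if_cong)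
    then show ?thesis using y that carrier_matD[OF mat_diag_dim[of r \<zeta>]]
      by (simp add: algebra_simps del: index_mult_mat_vec)
  qed
  have "d * vec_l2norm y = L2_set (\<lambda>i. d * cmod (y $ i)) {..<r}"
    using y \<open>0 \<le> d\<close> by (simp add: vec_l2norm_def L2_set_right_distrib)
  also have "\<dots> \<le> L2_set (\<lambda>i. cmod ((z \<cdot>\<^sub>v y - mat_diag r \<zeta> *\<^sub>v y) $ i)) {..<r}"
    using gap \<open>0 \<le> d\<close> by (intro L2_set_mono) (auto simp: ent norm_mult mult_right_mono simp del: index_minus_vec)
  also have "\<dots> = vec_l2norm (z \<cdot>\<^sub>v y - mat_diag r \<zeta> *\<^sub>v y)"
    by (simp add: vec_l2norm_def mat_diag_def)
  finally show ?thesis .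
qed

text \<open>
  If \<open>x\<close> is an eigenvector and \<open>y = Y x\<close>, then \<open>(z - D) y = Y M X y\<close>. The left side has norm at
  least \<open>min\<^sub>j \<bar>z - \<zeta>\<^sub>j\<bar> \<parallel>y\<parallel>\<close>, the right side at most \<open>\<parallel>Y\<parallel> c \<parallel>X\<parallel> \<parallel>y\<parallel>\<close>. The size of \<open>M\<close>
  enters as a pointwise bound, which passes to multiples \<open>t M\<close> without computing their norms.
\<close>

lemma bauer_fike:
  assumes X: "X \<in> carrier_mat r r" and Y: "Y \<in> carrier_mat r r" and YX: "Y * X = 1\<^sub>m r"
    and M: "M \<in> carrier_mat r r" and "0 \<le> c"
    and bound: "\<And>v. v \<in> carrier_vec r \<Longrightarrow> vec_l2norm (M *\<^sub>v v) \<le> c * vec_l2norm v"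
    and ev: "eigenvalue (X * mat_diag r \<zeta> * Y + M) z"
  shows "\<exists>j<r. cmod (z - \<zeta> j) \<le> spectral_norm Y * spectral_norm X * c"
proof (rule ccontr)
  let ?k = "spectral_norm Y * spectral_norm X * c" and ?D = "mat_diag r \<zeta>"
  assume "\<not> ?thesis"
  then have far: "\<And>j. j < r \<Longrightarrow> ?k < cmod (z - \<zeta> j)" by force
  have D: "?D \<in> carrier_mat r r" by simp
  from ev obtain x where x: "x \<in> carrier_vec r" "x \<noteq> 0\<^sub>v r"
    and eq: "(X * ?D * Y + M) *\<^sub>v x = z \<cdot>\<^sub>v x"
    using M by (auto simp: eigenvalue_def eigenvector_def)
  define y where "y = Y *\<^sub>v x"
  have y: "y \<in> carrier_vec r" using Y x by (simp add: y_def)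
  have XY: "X * Y = 1\<^sub>m r" using mat_mult_left_right_inverse[OF Y X YX] .
  have Dy: "?D *\<^sub>v y \<in> carrier_vec r" using D y by (rule mult_mat_vec_carrier)
  have Xy: "X *\<^sub>v y = x" using X Y x XY by (simp add: y_def assoc_mult_mat_vec[symmetric])
  have YXv: "Y *\<^sub>v (X *\<^sub>v w) = w" if "w \<in> carrier_vec r" for w
    using X Y that YX by (simp add: assoc_mult_mat_vec[symmetric])
  have eq': "X *\<^sub>v (?D *\<^sub>v y) + M *\<^sub>v x = z \<cdot>\<^sub>v x"
  proof -
    have "(X * ?D * Y + M) *\<^sub>v x = (X * ?D * Y) *\<^sub>v x + M *\<^sub>v x"
      using X Y M x by (intro add_mult_distrib_mat_vec[of _ r r]) auto
    also have "(X * ?D * Y) *\<^sub>v x = X *\<^sub>v (?D *\<^sub>v y)"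
      using X Y x D by (simp add: y_def assoc_mult_mat_vec[of _ r r _ r])
    finally show ?thesis using eq by simp
  qed
  have "Y *\<^sub>v (z \<cdot>\<^sub>v x) = Y *\<^sub>v (X *\<^sub>v (?D *\<^sub>v y)) + Y *\<^sub>v (M *\<^sub>v x)"
    unfolding eq'[symmetric] using X Y M x Dy by (intro mult_add_distrib_mat_vec[of _ r r]) auto
  then have "z \<cdot>\<^sub>v y = ?D *\<^sub>v y + Y *\<^sub>v (M *\<^sub>v x)"
    using YXv[of "?D *\<^sub>v y"] Dy mult_mat_vec[OF Y x(1)] by (simp add: y_def)
  moreover have cancel: "(v + w) - v = w" if "v \<in> carrier_vec r" "w \<in> carrier_vec r"
    for v w :: "complex Matrix.vec"
    using that by (intro eq_vecI) auto
  ultimately have diff: "z \<cdot>\<^sub>v y - ?D *\<^sub>v y = Y *\<^sub>v (M *\<^sub>v x)"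
    using cancel[OF Dy, of "Y *\<^sub>v (M *\<^sub>v x)"] Y M x by simp
  have y0: "vec_l2norm y > 0"
    using vec_l2norm_eq_0[OF y] Xy X x vec_l2norm_nonneg[of y] by (auto simp: less_le)
  have "vec_l2norm (Y *\<^sub>v (M *\<^sub>v x)) \<le> spectral_norm Y * (c * vec_l2norm x)"
    using vec_l2norm_mult_mat_vec[OF Y, of "M *\<^sub>v x"] bound[OF x(1)] M x
    by (meson mult_left_mono mult_mat_vec_carrier order_trans spectral_norm_nonneg)
  also have "\<dots> \<le> spectral_norm Y * (c * (spectral_norm X * vec_l2norm y))"
    using vec_l2norm_mult_mat_vec[OF X y] \<open>0 \<le> c\<close> unfolding Xy by (intro mult_left_mono) auto
  finally have upper: "vec_l2norm (Y *\<^sub>v (M *\<^sub>v x)) \<le> ?k * vec_l2norm y" by (simp add: mult_ac)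
  \<comment> \<open>A uniform gap larger than \<open>?k\<close>; the element \<open>?k + 1\<close> only keeps the set nonempty when \<open>r = 0\<close>.\<close>
  define d where "d = Min (insert (?k + 1) ((\<lambda>j. cmod (z - \<zeta> j)) ` {..<r}))"
  have "?k < d" unfolding d_def using far by simp
  moreover have "d * vec_l2norm y \<le> ?k * vec_l2norm y"
  proof -
    have "0 \<le> ?k" using \<open>0 \<le> c\<close> by simp
    then have "0 \<le> d" using \<open>?k < d\<close> by linarith
    then have "d * vec_l2norm y \<le> vec_l2norm (z \<cdot>\<^sub>v y - ?D *\<^sub>v y)"
      by (intro diag_shift_lower_bound y) (auto simp: d_def)
    then show ?thesis using upper diff by simp
  qed
  ultimately show False using y0 by simp
qed

lemma continuous_on_char_poly_segment:
  assumes A: "A \<in> carrier_mat r r" and M: "M \<in> carrier_mat r r"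
  shows "continuous_on T (\<lambda>t. poly (char_poly (A + complex_of_real t \<cdot>\<^sub>m M)) z)"
proof -
  have "poly (char_poly (A + complex_of_real t \<cdot>\<^sub>m M)) z =
    (\<Sum>p | p permutes {0..<r}. signof p * (\<Prod>i = 0..<r.
      (if i = p i then z else 0) - A $$ (i, p i) - complex_of_real t * M $$ (i, p i)))" for t
  proof -
    have C: "A + complex_of_real t \<cdot>\<^sub>m M \<in> carrier_mat r r" using A M by simp
    show ?thesis
      unfolding char_poly_matrix[OF C]
      by (subst det_def'[of _ r]) (use A M in \<open>auto simp: char_matrix_def permutes_in_image intro!: sum.cong prod.cong\<close>)
  qed
  then show ?thesis
    by (auto intro!: continuous_intros)
qed

lemma char_poly_diagonalizable:
  fixes X Y :: "complex mat"
  assumes X: "X \<in> carrier_mat r r" and Y: "Y \<in> carrier_mat r r" and YX: "Y * X = 1\<^sub>m r"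
  shows "char_poly (X * mat_diag r \<zeta> * Y) = (\<Prod>i<r. [:- \<zeta> i, 1:])"
proof -
  let ?D = "mat_diag r \<zeta>"
  have D: "?D \<in> carrier_mat r r" by simp
  have "similar_mat (X * ?D * Y) ?D"
    using X Y D YX mat_mult_left_right_inverse[OF Y X YX]
    by (intro similar_matI[of _ _ X Y r]) auto
  then have "char_poly (X * ?D * Y) = char_poly ?D" by (rule char_poly_similar)
  also have "\<dots> = (\<Prod>a\<leftarrow>diag_mat ?D. [:- a, 1:])"
    by (rule char_poly_upper_triangular[OF D]) (auto simp: mat_diag_def)
  also have "diag_mat ?D = map \<zeta> [0..<r]"
    by (simp add: diag_mat_def mat_diag_def)
  also have "(\<Prod>a\<leftarrow>map \<zeta> [0..<r]. [:- a, 1:]) = (\<Prod>i<r. [:- \<zeta> i, 1:])"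
    by (simp add: o_def prod.list_conv_set_nth atLeast0LessThan)
  finally show ?thesis .
qed

text \<open>
  Only the counts in the sets \<open>D j\<close> and the total size are given; since the \<open>r\<close> elements found in
  the disjoint sets already make up the total, no element lies elsewhere.
\<close>

lemma label_by_disjoint_sets:
  fixes R :: "'a multiset" and D :: "nat \<Rightarrow> 'a set"
  assumes size: "size R = r"
    and one: "\<And>j. j < r \<Longrightarrow> size (filter_mset (\<lambda>z. z \<in> D j) R) = 1"
    and disj: "\<And>i j. i < r \<Longrightarrow> j < r \<Longrightarrow> i \<noteq> j \<Longrightarrow> D i \<inter> D j = {}"
  shows "\<exists>\<mu>. image_mset \<mu> (mset_set {..<r}) = R \<and> (\<forall>j<r. \<forall>i<r. \<mu> i \<in> D j \<longleftrightarrow> i = j)"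
proof -
  have "\<forall>j. \<exists>z. j < r \<longrightarrow> filter_mset (\<lambda>z. z \<in> D j) R = {#z#}"
    using one size_1_singleton_mset by blast
  then obtain \<mu> where \<mu>: "\<And>j. j < r \<Longrightarrow> filter_mset (\<lambda>z. z \<in> D j) R = {#\<mu> j#}"
    by metis
  have mem: "\<mu> j \<in># R \<and> \<mu> j \<in> D j" if "j < r" for j
    using arg_cong[OF \<mu>[OF that], of set_mset] by auto
  have iff: "\<mu> i \<in> D j \<longleftrightarrow> i = j" if "i < r" "j < r" for i j
    using mem disj that by (cases "i = j") blast+
  have inj: "inj_on \<mu> {..<r}"
    using iff mem by (metis inj_onI lessThan_iff)
  have "mset_set (\<mu> ` {..<r}) \<subseteq># mset_set (set_mset R)"
    using mem by (intro subset_imp_msubset_mset_set) auto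
  also have "\<dots> \<subseteq># R" by (rule mset_set_set_mset_msubset)
  finally have "image_mset \<mu> (mset_set {..<r}) \<subseteq># R"
    by (simp add: image_mset_mset_set[OF inj])
  moreover have "\<not> image_mset \<mu> (mset_set {..<r}) \<subset># R"
    using mset_subset_size[of "image_mset \<mu> (mset_set {..<r})" R] size by auto
  ultimately have "image_mset \<mu> (mset_set {..<r}) = R"
    by (simp add: subset_mset.less_le)
  then show ?thesis using iff by blast
qed

text \<open>
  Consider \<open>A + t M\<close> with \<open>A = X D Y\<close> and \<open>0 \<le> t \<le> 1\<close>: by Bauer and Fike its eigenvalues stay in the union of the
  fixed disks of radius \<open>\<kappa>\<close>. Each disk in turn is separated from the union of the others, and the
  count in it is read off at \<open>t = 0\<close>, where the eigenvalues are the centres.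
\<close>

lemma eigenvalues_labelled_by_disks:
  fixes X Y M :: "complex mat"
  assumes X: "X \<in> carrier_mat r r" and Y: "Y \<in> carrier_mat r r" and YX: "Y * X = 1\<^sub>m r"
    and M: "M \<in> carrier_mat r r" and "0 \<le> c"
    and bound: "\<And>v. v \<in> carrier_vec r \<Longrightarrow> vec_l2norm (M *\<^sub>v v) \<le> c * vec_l2norm v"
    and \<kappa>: "spectral_norm Y * spectral_norm X * c \<le> \<kappa>"
    and sep: "\<And>i j. i < r \<Longrightarrow> j < r \<Longrightarrow> i \<noteq> j \<Longrightarrow> 2 * \<kappa> < cmod (\<zeta> i - \<zeta> j)"
  shows "\<exists>\<mu>. image_mset \<mu> (mset_set {..<r}) = proots (char_poly (X * mat_diag r \<zeta> * Y + M)) \<and>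
           (\<forall>j<r. \<forall>i<r. cmod (\<mu> i - \<zeta> j) \<le> \<kappa> \<longleftrightarrow> i = j)"
proof -
  define A where "A = X * mat_diag r \<zeta> * Y"
  define P where "P t = char_poly (A + complex_of_real t \<cdot>\<^sub>m M)" for t
  define D where "D j = cball (\<zeta> j) \<kappa>" for j
  have A: "A \<in> carrier_mat r r"
    unfolding A_def using X Y by (meson mat_diag_dim mult_carrier_mat)
  have C: "A + complex_of_real t \<cdot>\<^sub>m M \<in> carrier_mat r r" for t using A M by simp
  have monic: "degree (P t) = r" "lead_coeff (P t) = 1" for t
    using degree_monic_char_poly[OF C[of t]] by (auto simp: P_def)
  have "0 \<le> spectral_norm Y * spectral_norm X * c" using \<open>0 \<le> c\<close> by simp
  then have "0 \<le> \<kappa>" using \<kappa> by linarith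
  have disj: "D i \<inter> D j = {}" if "i < r" "j < r" "i \<noteq> j" for i j
  proof -
    have "\<kappa> + \<kappa> < dist (\<zeta> i) (\<zeta> j)" using sep[OF that] by (simp add: dist_norm)
    moreover have "dist (\<zeta> i) (\<zeta> j) \<le> \<kappa> + \<kappa>" if "z \<in> D i" "z \<in> D j" for z
      using that dist_triangle2[of "\<zeta> i" "\<zeta> j" z] by (simp add: D_def)
    ultimately show ?thesis by fastforce
  qed
  have roots: "\<exists>j<r. z \<in> D j" if t: "t \<in> {0..1}" and z: "poly (P t) z = 0" for t z
  proof -
    have "vec_l2norm ((complex_of_real t \<cdot>\<^sub>m M) *\<^sub>v v) \<le> c * vec_l2norm v"
      if v: "v \<in> carrier_vec r" for v
    proof -
      have "(complex_of_real t \<cdot>\<^sub>m M) *\<^sub>v v = complex_of_real t \<cdot>\<^sub>v (M *\<^sub>v v)"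
        using M v by (intro eq_vecI) auto
      then have "vec_l2norm ((complex_of_real t \<cdot>\<^sub>m M) *\<^sub>v v) = t * vec_l2norm (M *\<^sub>v v)"
        using t by (simp add: vec_l2norm_smult)
      also have "\<dots> \<le> 1 * vec_l2norm (M *\<^sub>v v)" using t by (intro mult_right_mono) auto
      also have "\<dots> \<le> c * vec_l2norm v" using bound[OF v] by simp
      finally show ?thesis .
    qed
    moreover have "eigenvalue (A + complex_of_real t \<cdot>\<^sub>m M) z"
      using z eigenvalue_root_char_poly[OF C] by (simp add: P_def)
    ultimately have "\<exists>j<r. cmod (z - \<zeta> j) \<le> spectral_norm Y * spectral_norm X * c"
      using X Y YX M \<open>0 \<le> c\<close> unfolding A_def by (intro bauer_fike) auto
    then show ?thesis using \<kappa> by (fastforce simp: D_def dist_norm norm_minus_commute)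
  qed
  have one: "size (filter_mset (\<lambda>z. z \<in> D j) (proots (P 1))) = 1" if j: "j < r" for j
  proof -
    let ?L = "\<Union>i\<in>{..<r} - {j}. D i"
    have "size (filter_mset (\<lambda>z. z \<in> D j) (proots (P 1)))
        = size (filter_mset (\<lambda>z. z \<in> D j) (proots (P 0)))"
    proof (rule root_count_constant[where T = "{0..1::real}" and L = ?L and n = r])
      show "connected {0..1::real}" "closed {0..1::real}" by auto
      show "compact (D j)" by (simp add: D_def)
      show "compact ?L" by (intro compact_UN) (auto simp: D_def)
      show "D j \<inter> ?L = {}" using disj j by blast
      show "continuous_on {0..1} (\<lambda>t. poly (P t) z)" for z
        unfolding P_def by (rule continuous_on_char_poly_segment[OF A M])
      show "z \<in> D j \<union> ?L" if "t \<in> {0..1}" "poly (P t) z = 0" for t z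
        using roots[OF that] by blast
    qed (use monic in auto)
    also have "A + complex_of_real 0 \<cdot>\<^sub>m M = A" using A M by (intro eq_matI) auto
    then have "P 0 = (\<Prod>i<r. [:- \<zeta> i, 1:])"
      using char_poly_diagonalizable[OF X Y YX] by (simp add: P_def A_def)
    then have "size (filter_mset (\<lambda>z. z \<in> D j) (proots (P 0))) = card {i \<in> {..<r}. \<zeta> i \<in> D j}"
      by (simp add: proots_prod_linear_factors filter_mset_image_mset filter_mset_mset_set)
    also have "{i \<in> {..<r}. \<zeta> i \<in> D j} = {j}"
    proof -
      have centre: "\<zeta> i \<in> D i" for i using \<open>0 \<le> \<kappa>\<close> by (simp add: D_def)
      then show ?thesis using disj j by blast
    qed
    finally show ?thesis by simp
  qed
  have "size (proots (P 1)) = r" by (simp add: size_proots_complex monic)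
  then obtain \<mu> where "image_mset \<mu> (mset_set {..<r}) = proots (P 1)"
    "\<forall>j<r. \<forall>i<r. \<mu> i \<in> D j \<longleftrightarrow> i = j"
    using label_by_disjoint_sets[of "proots (P 1)" r D] one disj by blast
  moreover have "A + complex_of_real 1 \<cdot>\<^sub>m M = A + M" using A M by (intro eq_matI) auto
  then have "P 1 = char_poly (A + M)" by (simp add: P_def)
  ultimately show ?thesis
    by (auto simp: A_def D_def dist_norm norm_minus_commute intro!: exI[of _ \<mu>])
qed

section \<open>Perturbation of the pencil\<close>

text \<open>
  A quantitative form of the Neumann series argument: \<open>w = H\<^sub>0\<^sup>-\<^sup>1 (H\<^sub>0 + E\<^sub>0) w - H\<^sub>0\<^sup>-\<^sup>1 E\<^sub>0 w\<close>, and
  the last term is absorbed on the left. Stating it for vectors makes it yield the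
  injectivity of \<open>H\<^sub>0 + E\<^sub>0\<close> as well.
\<close>

lemma perturbed_solution_bound:
  assumes H0: "H0 \<in> carrier_mat r r" "det H0 \<noteq> 0" and E0: "E0 \<in> carrier_mat r r"
    and \<eta>: "spectral_norm (minv H0 * E0) < 1"
    and w: "w \<in> carrier_vec r"
  shows "vec_l2norm w \<le> spectral_norm (minv H0) / (1 - spectral_norm (minv H0 * E0))
           * vec_l2norm ((H0 + E0) *\<^sub>v w)"
proof -
  note I = minv_inverse[OF H0]
  let ?g = "(H0 + E0) *\<^sub>v w" and ?\<eta> = "spectral_norm (minv H0 * E0)"
  have G: "?g \<in> carrier_vec r" using H0 E0 w by (intro mult_mat_vec_carrier[of _ r r]) auto
  have "minv H0 *\<^sub>v ?g = minv H0 *\<^sub>v (H0 *\<^sub>v w) + minv H0 *\<^sub>v (E0 *\<^sub>v w)"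
    using H0 E0 w I(1)
    by (subst add_mult_distrib_mat_vec[of _ r r], auto intro!: mult_add_distrib_mat_vec[of _ r r])
  also have "minv H0 *\<^sub>v (H0 *\<^sub>v w) = w"
    using H0 w I by (simp add: assoc_mult_mat_vec[symmetric])
  also have "minv H0 *\<^sub>v (E0 *\<^sub>v w) = (minv H0 * E0) *\<^sub>v w"
    using E0 w I by (simp add: assoc_mult_mat_vec[of _ r r _ r])
  finally have "w = minv H0 *\<^sub>v ?g - (minv H0 * E0) *\<^sub>v w"
    using w E0 I(1) by (intro eq_vecI) auto
  then have "vec_l2norm w \<le> vec_l2norm (minv H0 *\<^sub>v ?g) + vec_l2norm ((minv H0 * E0) *\<^sub>v w)"
    using vec_l2norm_diff[of "minv H0 *\<^sub>v ?g" r "(minv H0 * E0) *\<^sub>v w"] w E0 I(1) G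
    by (metis mult_carrier_mat mult_mat_vec_carrier)
  also have "\<dots> \<le> spectral_norm (minv H0) * vec_l2norm ?g + ?\<eta> * vec_l2norm w"
    using I(1) E0 w G by (intro add_mono vec_l2norm_mult_mat_vec[of _ r r]) auto
  finally have "(1 - ?\<eta>) * vec_l2norm w \<le> spectral_norm (minv H0) * vec_l2norm ?g"
    by (simp add: algebra_simps)
  then show ?thesis using \<eta> by (simp add: field_simps)
qed

text \<open>
  Here \<open>A\<close> and \<open>Ah\<close> stand for the quotients of the exact and of the perturbed pencil. Their
  difference satisfies \<open>(H\<^sub>0 + E\<^sub>0) (Ah - A) = E\<^sub>1 - E\<^sub>0 A\<close>.
\<close>

lemma pencil_quotient_perturbation:
  assumes H0: "H0 \<in> carrier_mat r r" "det H0 \<noteq> 0" and E0: "E0 \<in> carrier_mat r r"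
    and \<eta>: "spectral_norm (minv H0 * E0) < 1"
    and A: "A \<in> carrier_mat r r" and E1: "E1 \<in> carrier_mat r r"
    and Ah: "Ah \<in> carrier_mat r r" and eq: "(H0 + E0) * Ah = H0 * A + E1"
    and v: "v \<in> carrier_vec r"
  shows "vec_l2norm ((Ah - A) *\<^sub>v v) \<le> spectral_norm (minv H0) / (1 - spectral_norm (minv H0 * E0))
           * (spectral_norm E1 + spectral_norm E0 * spectral_norm A) * vec_l2norm v"
proof -
  let ?w = "(Ah - A) *\<^sub>v v" and ?\<eta> = "spectral_norm (minv H0 * E0)"
  have Av: "A *\<^sub>v v \<in> carrier_vec r" "Ah *\<^sub>v v \<in> carrier_vec r" using A Ah v by auto
  have w: "?w \<in> carrier_vec r" using A Ah v by (intro mult_mat_vec_carrier[of _ r r]) auto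
  have weq: "?w = Ah *\<^sub>v v - A *\<^sub>v v" using A Ah v by (intro minus_mult_distrib_mat_vec[of _ r r])
  have "(H0 + E0) *\<^sub>v ?w = (H0 + E0) *\<^sub>v (Ah *\<^sub>v v) - (H0 + E0) *\<^sub>v (A *\<^sub>v v)"
    unfolding weq using H0 E0 Av by (intro mult_minus_distrib_mat_vec[of _ r r]) auto
  also have "(H0 + E0) *\<^sub>v (Ah *\<^sub>v v) = (H0 * A + E1) *\<^sub>v v"
    unfolding eq[symmetric] using H0 E0 Ah v by (intro assoc_mult_mat_vec[of _ r r _ r, symmetric]) auto
  also have "\<dots> = H0 *\<^sub>v (A *\<^sub>v v) + E1 *\<^sub>v v"
    using H0 A E1 v by (simp add: add_mult_distrib_mat_vec[of _ r r] assoc_mult_mat_vec[of _ r r _ r])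
  also have "(H0 + E0) *\<^sub>v (A *\<^sub>v v) = H0 *\<^sub>v (A *\<^sub>v v) + E0 *\<^sub>v (A *\<^sub>v v)"
    using H0 E0 Av by (intro add_mult_distrib_mat_vec[of _ r r]) auto
  finally have res: "(H0 + E0) *\<^sub>v ?w = E1 *\<^sub>v v - E0 *\<^sub>v (A *\<^sub>v v)"
    using H0 E0 E1 Av v by (intro eq_vecI) (auto simp del: index_mult_mat_vec)
  have "vec_l2norm (E1 *\<^sub>v v - E0 *\<^sub>v (A *\<^sub>v v)) \<le> vec_l2norm (E1 *\<^sub>v v) + vec_l2norm (E0 *\<^sub>v (A *\<^sub>v v))"
    using E0 E1 Av v by (intro vec_l2norm_diff[of _ r]) auto
  also have "\<dots> \<le> spectral_norm E1 * vec_l2norm v + spectral_norm E0 * (spectral_norm A * vec_l2norm v)"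
  proof (rule add_mono)
    show "vec_l2norm (E1 *\<^sub>v v) \<le> spectral_norm E1 * vec_l2norm v"
      by (rule vec_l2norm_mult_mat_vec[OF E1 v])
    have "vec_l2norm (E0 *\<^sub>v (A *\<^sub>v v)) \<le> spectral_norm E0 * vec_l2norm (A *\<^sub>v v)"
      by (rule vec_l2norm_mult_mat_vec[OF E0 Av(1)])
    also have "\<dots> \<le> spectral_norm E0 * (spectral_norm A * vec_l2norm v)"
      by (intro mult_left_mono vec_l2norm_mult_mat_vec[OF A v]) simp
    finally show "vec_l2norm (E0 *\<^sub>v (A *\<^sub>v v)) \<le> spectral_norm E0 * (spectral_norm A * vec_l2norm v)" .
  qed
  finally have rhs: "vec_l2norm ((H0 + E0) *\<^sub>v ?w)
      \<le> (spectral_norm E1 + spectral_norm E0 * spectral_norm A) * vec_l2norm v"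
    unfolding res by (simp add: algebra_simps)
  have "vec_l2norm ?w \<le> spectral_norm (minv H0) / (1 - ?\<eta>) * vec_l2norm ((H0 + E0) *\<^sub>v ?w)"
    by (rule perturbed_solution_bound[OF H0 E0 \<eta> w])
  also have "\<dots> \<le> spectral_norm (minv H0) / (1 - ?\<eta>)
      * ((spectral_norm E1 + spectral_norm E0 * spectral_norm A) * vec_l2norm v)"
    using \<eta> by (intro mult_left_mono rhs) auto
  finally show ?thesis by (simp add: mult_ac)
qed

text \<open>
  From \<open>N B - z N = - N (z - B)\<close>; the sign comes out of the determinant as \<open>(-1)\<^sup>r\<close>. Thus the
  multiplicities of the generalized eigenvalues are those of the eigenvalues of \<open>B\<close>.
\<close>

lemma pencil_poly_eq_char_poly:
  assumes N: "N \<in> carrier_mat r r" and B: "B \<in> carrier_mat r r"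
  shows "pencil_poly (N * B) N = smult ((-1) ^ r * det N) (char_poly B)"
proof -
  have "poly (pencil_poly (N * B) N) z = poly (smult ((-1) ^ r * det N) (char_poly B)) z" for z
  proof -
    have "poly (pencil_poly (N * B) N) z = det (N * B - z \<cdot>\<^sub>m N)"
      unfolding pencil_poly_def using N B by (intro poly_det_cong[of _ r]) auto
    also have "N * B - z \<cdot>\<^sub>m N = N * ((-1) \<cdot>\<^sub>m (- char_matrix B z))"
    proof -
      have "(-1) \<cdot>\<^sub>m (- char_matrix B z) = B - z \<cdot>\<^sub>m 1\<^sub>m r"
        using B by (intro eq_matI) (auto simp: char_matrix_def)
      also have "N * \<dots> = N * B - N * (z \<cdot>\<^sub>m 1\<^sub>m r)"
        using N B by (intro mult_minus_distrib_mat) auto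
      finally show ?thesis using N by (simp add: mult_smult_distrib[of N r r "1\<^sub>m r" r])
    qed
    also have "det \<dots> = det N * ((-1) ^ r * det (- char_matrix B z))"
      using N B char_matrix_closed[OF B, of z] by (subst det_mult[of _ r]) (auto simp: char_matrix_def)
    also have "\<dots> = poly (smult ((-1) ^ r * det N) (char_poly B)) z"
      by (simp add: char_poly_matrix[OF B])
    finally show ?thesis .
  qed
  then show ?thesis by (simp add: fun_eq_iff flip: poly_eq_poly_eq_iff)
qed

lemma gen_eigenvalue_imp_eigenvalue:
  assumes N: "N \<in> carrier_mat r r" "det N \<noteq> 0" and B: "B \<in> carrier_mat r r"
    and ev: "gen_eigenvalue (N * B) N z"
  shows "eigenvalue B z"
proof -
  note I = minv_inverse[OF N]
  obtain x where x: "x \<in> carrier_vec r" "x \<noteq> 0\<^sub>v r" and eq: "(N * B) *\<^sub>v x = z \<cdot>\<^sub>v (N *\<^sub>v x)"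
    using ev N B by (auto simp: gen_eigenvalue_def)
  have inv: "minv N *\<^sub>v (N *\<^sub>v v) = v" if "v \<in> carrier_vec r" for v
    using N I that by (simp add: assoc_mult_mat_vec[symmetric])
  have Bx: "B *\<^sub>v x \<in> carrier_vec r" using B x by auto
  have "B *\<^sub>v x = minv N *\<^sub>v (N *\<^sub>v (B *\<^sub>v x))" using inv[OF Bx] by simp
  also have "N *\<^sub>v (B *\<^sub>v x) = z \<cdot>\<^sub>v (N *\<^sub>v x)"
    using N B x eq by (simp add: assoc_mult_mat_vec[of _ r r _ r])
  also have "minv N *\<^sub>v \<dots> = z \<cdot>\<^sub>v (minv N *\<^sub>v (N *\<^sub>v x))"
    using N I x by (intro mult_mat_vec) auto
  finally have "B *\<^sub>v x = z \<cdot>\<^sub>v x" using inv[OF x(1)] by simp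
  then show ?thesis using x B by (auto simp: eigenvalue_def eigenvector_def)
qed

lemma node_sepD:
  assumes "ereal c < node_sep r \<zeta> / 2" "i < r" "j < r" "i \<noteq> j"
  shows "2 * c < cmod (\<zeta> i - \<zeta> j)"
proof -
  have "node_sep r \<zeta> \<le> ereal (cmod (\<zeta> i - \<zeta> j))"
    unfolding node_sep_def using assms by (intro INF_lower2[of "(i, j)"]) auto
  then have "node_sep r \<zeta> / 2 \<le> ereal (cmod (\<zeta> i - \<zeta> j)) / 2"
    by (intro ereal_divide_right_mono) auto
  then have "ereal c < ereal (cmod (\<zeta> i - \<zeta> j)) / 2" using assms(1) by (rule less_le_trans[rotated])
  then show ?thesis by (simp add: field_simps)
qed

section \<open>Perturbation bound for the nodes\<close>

theorem proposition2p3: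
  fixes r :: nat
    and \<omega> \<zeta> :: "nat \<Rightarrow> complex"
    and u :: "nat \<Rightarrow> complex"
    and H0 H1 V A E0 E1 H0h H1h :: "complex mat"
    and \<eta>0 \<Delta>A :: real
  assumes "r \<ge> 1"
    and "\<And>j. j < r \<Longrightarrow> \<omega> j \<noteq> 0"
    and "\<And>i j. i < r \<Longrightarrow> j < r \<Longrightarrow> i \<noteq> j \<Longrightarrow> \<zeta> i \<noteq> \<zeta> j"
    and "\<And>p. u p = (\<Sum>j<r. \<omega> j * \<zeta> j ^ p)"
    and "H0 = hankel_mat r 0 u"
    and "H1 = hankel_mat r 1 u"
    and "V = vandermonde_mat r \<zeta>"
    and "A = minv H0 * H1"
    and "E0 \<in> carrier_mat r r"
    and "E1 \<in> carrier_mat r r"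
    and "H0h = H0 + E0"
    and "H1h = H1 + E1"
    and "\<eta>0 = spectral_norm (minv H0 * E0)"
    and "\<eta>0 < 1"
    and "\<Delta>A = spectral_norm (minv H0) / (1 - \<eta>0)
               * (spectral_norm E1 + spectral_norm E0 * spectral_norm A)"
  shows "invertible_mat H0 \<and> invertible_mat V
         \<and> A = minv (transpose_mat V) * mat_diag r \<zeta> * transpose_mat V
         \<and> invertible_mat H0h
         \<and> (\<forall>z. gen_eigenvalue H1h H0h z \<longrightarrow>
              (MIN j\<in>{..<r}. cmod (z - \<zeta> j)) \<le> cond2 V * \<Delta>A)
         \<and> (ereal (cond2 V * \<Delta>A) < node_sep r \<zeta> / 2 \<longrightarrow>
              (\<exists>\<mu> :: nat \<Rightarrow> complex.
                 image_mset \<mu> (mset_set {..<r}) = gen_eigenvalues_mset H1h H0h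
                 \<and> (\<forall>j<r. \<forall>i<r. cmod (\<mu> i - \<zeta> j) \<le> cond2 V * \<Delta>A \<longleftrightarrow> i = j)))"
proof -
  have inj: "inj_on \<zeta> {..<r}" using assms(3) by (meson inj_onI lessThan_iff)
  have V: "V \<in> carrier_mat r r" using assms(7) by (simp add: vandermonde_mat_def)
  have dV: "det V \<noteq> 0" using det_vandermonde_mat[OF inj] assms(7) by simp
  define X Y where "X = minv (transpose_mat V)" and "Y = transpose_mat V"
  have Y: "Y \<in> carrier_mat r r" using V by (simp add: Y_def)
  have dY: "det Y \<noteq> 0" using det_transpose[OF V] dV by (simp add: Y_def)
  have X: "X \<in> carrier_mat r r" and YX: "Y * X = 1\<^sub>m r"
    using minv_inverse[OF Y dY] by (simp_all add: X_def Y_def)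
  have H0: "H0 \<in> carrier_mat r r" and H1: "H1 \<in> carrier_mat r r"
    using assms(5,6) by (simp_all add: hankel_mat_def)
  have d0: "det H0 \<noteq> 0" and A_eq: "A = X * mat_diag r \<zeta> * Y"
    using hankel_mat_quotient[OF inj assms(2,4)] assms(5-8) by (simp_all add: X_def Y_def)
  note I = minv_inverse[OF H0 d0]
  have E0: "E0 \<in> carrier_mat r r" and E1: "E1 \<in> carrier_mat r r" using assms(9,10) by auto
  have A: "A \<in> carrier_mat r r" using assms(8) I(1) H1 by simp
  have HA: "H0 * A = H1"
    unfolding assms(8) using assoc_mult_mat[OF H0 I(1) H1] I(2) H1 by (metis left_mult_one_mat)
  have \<eta>: "spectral_norm (minv H0 * E0) < 1" using assms(13,14) by simp
  have Hh: "H0h \<in> carrier_mat r r" "H1h \<in> carrier_mat r r" using assms(11,12) E0 E1 by auto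
  have dh: "det H0h \<noteq> 0"
  proof (rule det_nonzero_if_trivial_kernel[OF Hh(1)])
    fix v assume v: "v \<in> carrier_vec r" and "H0h *\<^sub>v v = 0\<^sub>v r"
    then have "vec_l2norm v \<le> 0"
      using perturbed_solution_bound[OF H0 d0 E0 \<eta> v] assms(11)
        iffD2[OF vec_l2norm_eq_0[OF zero_carrier_vec[of r]] refl]
      by simp
    then have "vec_l2norm v = 0" using vec_l2norm_nonneg[of v] by linarith
    then show "v = 0\<^sub>v r" using vec_l2norm_eq_0[OF v] by simp
  qed
  note Ih = minv_inverse[OF Hh(1) dh]
  define B where "B = minv H0h * H1h"
  have B: "B \<in> carrier_mat r r" using Ih(1) Hh by (simp add: B_def)
  have HB: "H0h * B = H1h"
    unfolding B_def using assoc_mult_mat[OF Hh(1) Ih(1) Hh(2)] Ih(2) Hh(2) by (metis left_mult_one_mat)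
  define M where "M = B - A"
  have M: "M \<in> carrier_mat r r" unfolding M_def using A by (rule minus_carrier_mat)
  \<comment> \<open>The exact quotient \<open>A\<close> is perturbed by \<open>M\<close> into the quotient \<open>B\<close> of the perturbed pencil.\<close>
  have AM: "X * mat_diag r \<zeta> * Y + M = B"
    unfolding A_eq[symmetric] M_def using A B by (intro eq_matI) auto
  have bound: "vec_l2norm (M *\<^sub>v v) \<le> \<Delta>A * vec_l2norm v" if "v \<in> carrier_vec r" for v
    using pencil_quotient_perturbation[OF H0 d0 E0 \<eta> A E1 B _ that] HB HA assms(11,12,13,15)
    by (simp add: M_def)
  have \<Delta>: "0 \<le> \<Delta>A" using assms(14,15) by simp
  have "spectral_norm Y \<le> spectral_norm V" "spectral_norm X \<le> spectral_norm (minv V)"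
    unfolding X_def Y_def minv_transpose[OF V dV]
    using spectral_norm_transpose_le[OF V] spectral_norm_transpose_le[OF minv_inverse(1)[OF V dV]] by auto
  then have \<kappa>: "spectral_norm Y * spectral_norm X * \<Delta>A \<le> cond2 V * \<Delta>A"
    unfolding cond2_def using \<Delta> by (intro mult_right_mono mult_mono) auto
  have "(MIN j\<in>{..<r}. cmod (z - \<zeta> j)) \<le> cond2 V * \<Delta>A" if "gen_eigenvalue H1h H0h z" for z
  proof -
    have "eigenvalue B z"
      using gen_eigenvalue_imp_eigenvalue[OF Hh(1) dh B] that HB by simp
    then obtain j where j: "j < r" "cmod (z - \<zeta> j) \<le> spectral_norm Y * spectral_norm X * \<Delta>A"
      using bauer_fike[OF X Y YX M \<Delta> bound] AM by auto
    have "(MIN j\<in>{..<r}. cmod (z - \<zeta> j)) \<le> cmod (z - \<zeta> j)" using j(1) by (intro Min_le) auto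
    then show ?thesis using j(2) \<kappa> by linarith
  qed
  moreover have "\<exists>\<mu>. image_mset \<mu> (mset_set {..<r}) = gen_eigenvalues_mset H1h H0h
      \<and> (\<forall>j<r. \<forall>i<r. cmod (\<mu> i - \<zeta> j) \<le> cond2 V * \<Delta>A \<longleftrightarrow> i = j)"
    if sep: "ereal (cond2 V * \<Delta>A) < node_sep r \<zeta> / 2"
  proof -
    have "gen_eigenvalues_mset H1h H0h = proots (char_poly B)"
      using pencil_poly_eq_char_poly[OF Hh(1) B] dh HB by (simp add: gen_eigenvalues_mset_def)
    moreover have "2 * (cond2 V * \<Delta>A) < cmod (\<zeta> i - \<zeta> j)" if "i < r" "j < r" "i \<noteq> j" for i j
      using node_sepD[OF sep] that by blast
    ultimately show ?thesis
      using eigenvalues_labelled_by_disks[OF X Y YX M \<Delta> bound \<kappa>, of \<zeta>] AM by simp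
  qed
  ultimately show ?thesis
    using I(4) minv_inverse(4)[OF V dV] Ih(4) A_eq by (simp add: X_def Y_def)
qed

end
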